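(* The following two statements are equivalent. (i) For every odd integer $n>5$ the system $$\begin{cases}\phi(n-x-y)+1=n-x-y\\ \phi(2x-n)+1=2x-n\\ \phi(n-x+y)+1=n-x+y\\ (n-x-y)(2x-n)\equiv 0 \pmod 3\end{cases}$$ has a solution $(x,y)$ in non-negative integers. (ii) (Binary Goldbach conjecture) Every even integer $2n$ with $n>1$ is a sum of two primes.
   Context: $\phi:\mathbb{N}\to\mathbb{N}$ is Euler's totient function on the positive integers: $\phi(a)$ is the number of integers among $1,2,\dots,a$ that are coprime to $a$. Since $\phi$ is defined only on positive integers, a solution $(x,y)$ of the system is a pair for which $n-x-y$, $2x-n$ and $n-x+y$ are all positive. Statement (i) is what the paper calls the "peculiar case of the ternary Goldbach theorem". *)

theory Defs
  imports "HOL-Number_Theory.Number_Theory"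
begin

end

theory Submission
  imports Defs
begin

text \<open>
  Since \<open>totient m = m - 1\<close> characterises the primes, the first three equations say that
  \<open>n - x - y\<close>, \<open>2 * x - n\<close> and \<open>n - x + y\<close> are primes; they sum to \<open>n\<close>, and the congruence forces
  one of the first two to be 3. Deleting that 3 from \<open>n = 2 * m + 3\<close> leaves \<open>2 * m\<close> as a sum of two
  primes. Conversely \<open>2 * m = p + q\<close> with \<open>p \<le> q\<close> gives the solution \<open>x = m + 3\<close>,
  \<open>y = (q - p) / 2\<close>.
\<close>

text \<open>A prime \<open>m\<close> is coprime to each of 1, ..., m - 1, while a composite
  \<open>m\<close> shares a factor with a proper divisor; \<open>m = 1\<close> fails because its
  totient is 1, not 0.\<close>

lemma pos_totient_plus_one_eq_iff_prime:
  fixes m :: int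
  shows "m > 0 \<and> int (totient (nat m)) + 1 = m \<longleftrightarrow> prime m"
proof
  assume m: "m > 0 \<and> int (totient (nat m)) + 1 = m"
  then have "totient (nat m) = nat m - 1" by linarith
  then have "prime (nat m)" using m by (intro totient_imp_prime) auto
  then show "prime m" by simp
next
  assume prime: "prime m"
  then have "prime (nat m)" by simp
  then have "totient (nat m) = nat m - 1" by (rule totient_prime)
  then show "m > 0 \<and> int (totient (nat m)) + 1 = m"
    using prime_gt_0_int[OF prime] by linarith
qed

text \<open>By Euclid's lemma 3 divides one of the two primes, and a prime divisible by 3 is
  3.\<close>

lemma prime_mult_cong_0_mod_3_iff:
  fixes a b :: int
  assumes "prime a" "prime b"
  shows "[a * b = 0] (mod 3) \<longleftrightarrow> a = 3 \<or> b = 3"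
proof -
  have prime3: "prime (3::int)" by simp
  show ?thesis
    using assms prime_dvd_mult_iff[OF prime3, of a b]
      primes_dvd_imp_eq[OF prime3, of a] primes_dvd_imp_eq[OF prime3, of b]
    by (auto simp: cong_0_iff)
qed

text \<open>The left side has the exact shape of the system, so that unfolding rewrites it under the
  quantifiers.\<close>

lemma totient_system_iff:
  fixes a b c :: int
  shows "(a > 0 \<and> b > 0 \<and> c > 0 \<and>
      int (totient (nat a)) + 1 = a \<and> int (totient (nat b)) + 1 = b \<and>
      int (totient (nat c)) + 1 = c \<and> [a * b = 0] (mod 3))
    \<longleftrightarrow> prime a \<and> prime b \<and> prime c \<and> (a = 3 \<or> b = 3)"
  using pos_totient_plus_one_eq_iff_prime[of a] pos_totient_plus_one_eq_iff_prime[of b]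
    pos_totient_plus_one_eq_iff_prime[of c] prime_mult_cong_0_mod_3_iff[of a b]
  by argo

theorem theorem3p6:
  "(\<forall>n::int. odd n \<and> n > 5 \<longrightarrow>
      (\<exists>x y :: int. x \<ge> 0 \<and> y \<ge> 0 \<and>
         n - x - y > 0 \<and> 2 * x - n > 0 \<and> n - x + y > 0 \<and>
         int (totient (nat (n - x - y))) + 1 = n - x - y \<and>
         int (totient (nat (2 * x - n))) + 1 = 2 * x - n \<and>
         int (totient (nat (n - x + y))) + 1 = n - x + y \<and>
         [(n - x - y) * (2 * x - n) = 0] (mod 3)))
   \<longleftrightarrow>
   (\<forall>n::int. n > 1 \<longrightarrow> (\<exists>p q :: int. prime p \<and> prime q \<and> 2 * n = p + q))"
  unfolding totient_system_iff
proof (intro iffI allI impI)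
  fix n :: int
  assume ternary: "\<forall>n::int. odd n \<and> n > 5 \<longrightarrow>
      (\<exists>x y. x \<ge> 0 \<and> y \<ge> 0 \<and> prime (n - x - y) \<and> prime (2 * x - n) \<and>
         prime (n - x + y) \<and> (n - x - y = 3 \<or> 2 * x - n = 3))"
    and "n > 1"
  then have "odd (2 * n + 3) \<and> 2 * n + 3 > 5" by simp
  with ternary obtain x y where primes: "prime (2 * n + 3 - x - y)"
      "prime (2 * x - (2 * n + 3))" "prime (2 * n + 3 - x + y)"
    and "2 * n + 3 - x - y = 3 \<or> 2 * x - (2 * n + 3) = 3" by blast
  then consider "2 * n = (2 * x - (2 * n + 3)) + (2 * n + 3 - x + y)"
    | "2 * n = (2 * n + 3 - x - y) + (2 * n + 3 - x + y)" by linarith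
  then show "\<exists>p q. prime p \<and> prime q \<and> 2 * n = p + q"
    using primes by cases blast+
next
  fix n :: int
  assume binary: "\<forall>n::int. n > 1 \<longrightarrow> (\<exists>p q. prime p \<and> prime q \<and> 2 * n = p + q)"
    and n: "odd n \<and> n > 5"
  then have "even (n - 3)" by simp
  then obtain m where "n - 3 = 2 * m" by (rule evenE)
  then have m: "n = 2 * m + 3" by simp
  with n have "m > 1" by simp
  with binary obtain p' q' where pq': "prime p'" "prime q'" "2 * m = p' + q'" by blast
  \<comment> \<open>Ordering the two primes makes the later \<open>y\<close> non-negative.\<close>
  obtain p q where pq: "prime p" "prime q" "2 * m = p + q" "p \<le> q"
    using pq' that[of p' q'] that[of q' p'] by linarith
  then have "even (q - p)" by presburger
  then obtain y where y: "q - p = 2 * y" by (rule evenE)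
  \<comment> \<open>The witness \<open>x = m + 3\<close> solves \<open>2 * x - n = 3\<close>; then
    \<open>n - x = m\<close> is the midpoint of \<open>p\<close> and \<open>q\<close>, and
    \<open>y\<close> is half their gap.\<close>
  have "n - (m + 3) - y = p" "2 * (m + 3) - n = 3" "n - (m + 3) + y = q"
    using m y pq(3) by simp_all
  moreover have "prime (3::int)" by simp
  moreover have "m + 3 \<ge> 0" "y \<ge> 0" using n m y pq(4) by linarith+
  ultimately show "\<exists>x y. x \<ge> 0 \<and> y \<ge> 0 \<and> prime (n - x - y) \<and> prime (2 * x - n) \<and>
      prime (n - x + y) \<and> (n - x - y = 3 \<or> 2 * x - n = 3)"
    using pq(1,2) by metis
qed

end
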